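(* Let $n\ge 1$ and $m\ge 3$, and let $W_{n,m}$ be the join of the edgeless graph $\overline{K_n}$ on $n$ vertices and the cycle $C_m$ (i.e., every vertex of $\overline{K_n}$ is joined to every vertex of $C_m$). Then player B wins the general position avoidance game on $W_{n,m}$ if and only if $m\ge 4$.
   Context: All graphs are finite and simple. A set $S$ of vertices of a graph $G$ is a general position set if no three distinct vertices of $S$ lie on a common shortest path (geodesic) of $G$. In the general position avoidance game on $G$, two players A and B alternately select vertices of $G$, with A moving first; a selection is legal if the vertex was not selected before and the set of all vertices selected so far is a general position set of $G$. The game ends when no legal move remains; the player who selects the last vertex loses. "Player X wins" means X has a winning strategy. *)

theory Defs
  imports "Graph_Theory.Graph_Theory"
begin

text \<open>
  A finite simple graph is a \<open>pair_graph\<close>: every edge is represented by its two opposite arcs.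
\<close>

subsection \<open>General position sets\<close>

definition geodesic :: "'a pair_pre_digraph \<Rightarrow> 'a \<Rightarrow> ('a \<times> 'a) awalk \<Rightarrow> 'a \<Rightarrow> bool" where
  "geodesic G u p v \<longleftrightarrow>
     pre_digraph.apath (with_proj G) u p v \<and>
     (\<forall>q. pre_digraph.apath (with_proj G) u q v \<longrightarrow> length p \<le> length q)"

definition general_position_set :: "'a pair_pre_digraph \<Rightarrow> 'a set \<Rightarrow> bool" where
  "general_position_set G S \<longleftrightarrow>
     S \<subseteq> pverts G \<and>
     \<not> (\<exists>x\<in>S. \<exists>y\<in>S. \<exists>z\<in>S. x \<noteq> y \<and> y \<noteq> z \<and> x \<noteq> z \<and>
          (\<exists>u p v. geodesic G u p v \<and>
             {x, y, z} \<subseteq> set (pre_digraph.awalk_verts (with_proj G) u p)))"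

subsection \<open>The general position avoidance game\<close>

datatype player = Player_A | Player_B

text \<open>A position is the list of the vertices selected so far, in order of selection.\<close>

definition to_move :: "nat \<Rightarrow> player" where
  "to_move k = (if even k then Player_A else Player_B)"

definition legal_moves :: "'a pair_pre_digraph \<Rightarrow> 'a list \<Rightarrow> 'a set" where
  "legal_moves G xs =
     {v \<in> pverts G. v \<notin> set xs \<and> general_position_set G (insert v (set xs))}"

definition legal_play :: "'a pair_pre_digraph \<Rightarrow> 'a list \<Rightarrow> bool" where
  "legal_play G xs \<longleftrightarrow> (\<forall>i < length xs. xs ! i \<in> legal_moves G (take i xs))"

definition follows :: "player \<Rightarrow> ('a list \<Rightarrow> 'a) \<Rightarrow> 'a list \<Rightarrow> bool" where
  "follows X \<sigma> xs \<longleftrightarrow> (\<forall>i < length xs. to_move i = X \<longrightarrow> xs ! i = \<sigma> (take i xs))"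

text \<open>
  A winning strategy must supply a legal move whenever it is consulted while the game is still
  running, and no finished play following it may have its last vertex selected by its owner.
\<close>

definition winning_strategy ::
    "'a pair_pre_digraph \<Rightarrow> player \<Rightarrow> ('a list \<Rightarrow> 'a) \<Rightarrow> bool" where
  "winning_strategy G X \<sigma> \<longleftrightarrow>
     (\<forall>xs. legal_play G xs \<and> follows X \<sigma> xs \<longrightarrow>
        (legal_moves G xs \<noteq> {} \<and> to_move (length xs) = X \<longrightarrow> \<sigma> xs \<in> legal_moves G xs) \<and>
        (legal_moves G xs = {} \<longrightarrow> xs \<noteq> [] \<and> to_move (length xs - 1) \<noteq> X))"

definition wins_gp_avoidance :: "player \<Rightarrow> 'a pair_pre_digraph \<Rightarrow> bool" where
  "wins_gp_avoidance X G \<longleftrightarrow> (\<exists>\<sigma>. winning_strategy G X \<sigma>)"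

subsection \<open>Generalised wheels\<close>

definition edgeless_graph :: "nat \<Rightarrow> nat pair_pre_digraph" where
  "edgeless_graph n = \<lparr> pverts = {..<n}, parcs = {} \<rparr>"

text \<open>For \<open>m < 3\<close> this is not the usual cycle (\<open>m = 1\<close> gives a loop).\<close>

definition cycle_graph :: "nat \<Rightarrow> nat pair_pre_digraph" where
  "cycle_graph m = \<lparr> pverts = {..<m},
     parcs = {(i, j). i < m \<and> j < m \<and> (j = (i + 1) mod m \<or> i = (j + 1) mod m)} \<rparr>"

definition graph_join ::
    "'a pair_pre_digraph \<Rightarrow> 'b pair_pre_digraph \<Rightarrow> ('a + 'b) pair_pre_digraph" where
  "graph_join G H = \<lparr> pverts = pverts G <+> pverts H,
     parcs = {(Inl u, Inl v) | u v. (u, v) \<in> parcs G}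
           \<union> {(Inr u, Inr v) | u v. (u, v) \<in> parcs H}
           \<union> {(Inl u, Inr v) | u v. u \<in> pverts G \<and> v \<in> pverts H}
           \<union> {(Inr v, Inl u) | u v. u \<in> pverts G \<and> v \<in> pverts H} \<rparr>"

definition wheel_join :: "nat \<Rightarrow> nat \<Rightarrow> (nat + nat) pair_pre_digraph" where
  "wheel_join n m = graph_join (edgeless_graph n) (cycle_graph m)"

lemma pair_graph_wheel_join:
  assumes "m \<ge> 3"
  shows "pair_graph (wheel_join n m)"
proof -
  let ?W = "wheel_join n m"
  have ne: "i \<noteq> Suc i mod m" if "i < m" for i
    using that assms by (cases "Suc i = m") auto
  have sub: "parcs ?W \<subseteq> pverts ?W \<times> pverts ?W"
    by (auto simp: wheel_join_def graph_join_def edgeless_graph_def cycle_graph_def)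
  have fin: "finite (pverts ?W)"
    by (auto simp: wheel_join_def graph_join_def edgeless_graph_def cycle_graph_def)
  have sym: "sym (parcs ?W)"
    by (auto simp: sym_def wheel_join_def graph_join_def edgeless_graph_def cycle_graph_def)
  have loops: "fst e \<noteq> snd e" if "e \<in> parcs ?W" for e
    using that
    by (auto simp: wheel_join_def graph_join_def edgeless_graph_def cycle_graph_def dest: ne)
  show ?thesis
  proof
    show "finite (parcs ?W)" using sub fin by (meson finite_SigmaI finite_subset)
  qed (use sub fin sym loops in \<open>auto simp: symmetric_def\<close>)
qed

end

theory Submission
  imports Defs
begin

text \<open>
  In a graph of diameter at most two the geodesics with three vertices are the induced paths, so a
  general position set is a set in which adjacency is transitive. In a join, such a set with a
  vertex on either side is a clique. Once both sides have been touched, the game thus ends exactly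
  when the selected set is a maximal clique of the join, that is, the union of a maximal clique of
  either side, and the winner is decided by the parity of its size. For the wheel the sizes are
  \<open>1 + 2\<close> if \<open>m \<ge> 4\<close>, where B touches the second side with the first reply, and \<open>1 + 3\<close> if
  \<open>m = 3\<close>, where the cycle is complete and A forces a clique by opening on it.
\<close>

section \<open>General position in graphs of diameter at most two\<close>

context pair_pre_digraph
begin

lemma general_position_setI:
  assumes "S \<subseteq> pverts G"
    and "\<And>x y z u p v. x \<in> S \<Longrightarrow> y \<in> S \<Longrightarrow> z \<in> S \<Longrightarrow> x \<noteq> y \<Longrightarrow> y \<noteq> z \<Longrightarrow> x \<noteq> z \<Longrightarrow>
      geodesic G u p v \<Longrightarrow> {x, y, z} \<subseteq> set (awalk_verts u p) \<Longrightarrow> False"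
  shows "general_position_set G S"
  unfolding general_position_set_def awalk_verts_with_proj_eq using assms by meson

lemma general_position_setD:
  assumes "general_position_set G S" "x \<in> S" "y \<in> S" "z \<in> S" "x \<noteq> y" "y \<noteq> z" "x \<noteq> z"
    and "geodesic G u p v"
  shows "\<not> {x, y, z} \<subseteq> set (awalk_verts u p)"
  using assms unfolding general_position_set_def awalk_verts_with_proj_eq by meson

end

definition induced_P3_free :: "'a pair_pre_digraph \<Rightarrow> 'a set \<Rightarrow> bool" where
  "induced_P3_free G S \<longleftrightarrow>
     (\<forall>x\<in>S. \<forall>y\<in>S. \<forall>z\<in>S. (x, y) \<in> parcs G \<longrightarrow> (y, z) \<in> parcs G \<longrightarrow> x = z \<or> (x, z) \<in> parcs G)"

lemma induced_P3_freeD: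
  assumes "induced_P3_free G S" "x \<in> S" "y \<in> S" "z \<in> S"
    and "(x, y) \<in> parcs G" "(y, z) \<in> parcs G" "x \<noteq> z"
  shows "(x, z) \<in> parcs G"
  using assms unfolding induced_P3_free_def by blast

definition clique :: "'a pair_pre_digraph \<Rightarrow> 'a set \<Rightarrow> bool" where
  "clique G S \<longleftrightarrow> S \<subseteq> pverts G \<and> pairwise (\<lambda>x y. (x, y) \<in> parcs G) S"

definition maximal_clique :: "'a pair_pre_digraph \<Rightarrow> 'a set \<Rightarrow> bool" where
  "maximal_clique G S \<longleftrightarrow> clique G S \<and> (\<forall>v. clique G (insert v S) \<longrightarrow> v \<in> S)"

lemma clique_subset_pverts: "clique G S \<Longrightarrow> S \<subseteq> pverts G"
  by (simp add: clique_def)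

lemma clique_empty [simp]: "clique G {}"
  by (simp add: clique_def)

lemma clique_subset: "clique G T \<Longrightarrow> S \<subseteq> T \<Longrightarrow> clique G S"
  by (auto simp: clique_def intro: pairwise_subset)

lemma clique_induced_P3_free: "clique G S \<Longrightarrow> induced_P3_free G S"
  by (auto simp: clique_def induced_P3_free_def pairwise_def)

lemma maximal_clique_eq_pverts:
  assumes "clique G (pverts G)" "maximal_clique G S"
  shows "S = pverts G"
proof
  show "S \<subseteq> pverts G"
    using assms(2) by (simp add: maximal_clique_def clique_subset_pverts)
  show "pverts G \<subseteq> S"
  proof
    fix v assume "v \<in> pverts G"
    then have "clique G (insert v S)"
      using clique_subset[OF assms(1)] \<open>S \<subseteq> pverts G\<close> by simp
    then show "v \<in> S"
      using assms(2) by (simp add: maximal_clique_def)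
  qed
qed

context pair_loopfree_digraph
begin

lemma apath_arc:
  assumes "(u, v) \<in> parcs G"
  shows "apath u [(u, v)] v"
  using assms wellformed'[OF assms] no_loops'[OF assms]
  by (auto simp: apath_def awalk_Cons_iff awalk_Nil_iff)

lemma apath_two_arcs:
  assumes "(u, w) \<in> parcs G" "(w, v) \<in> parcs G" "u \<noteq> v"
  shows "apath u [(u, w), (w, v)] v"
  using assms wellformed'[OF assms(1)] wellformed'[OF assms(2)]
    no_loops'[OF assms(1)] no_loops'[OF assms(2)]
  by (auto simp: apath_def awalk_Cons_iff awalk_Nil_iff)

lemma geodesic_two_arcs:
  assumes "(u, w) \<in> parcs G" "(w, v) \<in> parcs G" "u \<noteq> v" "(u, v) \<notin> parcs G"
  shows "geodesic G u [(u, w), (w, v)] v"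
  unfolding geodesic_def
proof (intro conjI allI impI)
  show "apath u [(u, w), (w, v)] v"
    using assms by (intro apath_two_arcs)
  fix q assume q: "apath u q v"
  show "length [(u, w), (w, v)] \<le> length q"
  proof (rule ccontr)
    assume "\<not> ?thesis"
    then consider "q = []" | e where "q = [e]"
      by (cases q; cases "tl q") auto
    then show False
      using q assms by cases (auto simp: apath_def awalk_Cons_iff awalk_Nil_iff)
  qed
qed

lemma general_position_set_induced_P3_free:
  assumes "general_position_set G S"
  shows "induced_P3_free G S"
  unfolding induced_P3_free_def
proof (intro ballI impI, rule ccontr)
  fix x y z
  assume S: "x \<in> S" "y \<in> S" "z \<in> S"
    and arcs: "(x, y) \<in> parcs G" "(y, z) \<in> parcs G"
    and nonadjacent: "\<not> (x = z \<or> (x, z) \<in> parcs G)"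
  have "geodesic G x [(x, y), (y, z)] z"
    using arcs nonadjacent by (intro geodesic_two_arcs) auto
  moreover have "x \<noteq> y" "y \<noteq> z" "x \<noteq> z"
    using arcs nonadjacent no_loops' by auto
  ultimately have "\<not> {x, y, z} \<subseteq> set (awalk_verts x [(x, y), (y, z)])"
    using general_position_setD[OF assms S] by blast
  then show False
    by simp
qed

end

locale diameter_two_graph = pair_graph +
  assumes common_neighbour:
    "u \<in> pverts G \<Longrightarrow> v \<in> pverts G \<Longrightarrow> u \<noteq> v \<Longrightarrow> (u, v) \<notin> parcs G \<Longrightarrow>
      \<exists>w. (u, w) \<in> parcs G \<and> (w, v) \<in> parcs G"
begin

lemma geodesic_of_length_ge_two:
  assumes "geodesic G u p v" "2 \<le> length p"
  obtains w where "p = [(u, w), (w, v)]" "(u, w) \<in> parcs G" "(w, v) \<in> parcs G"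
    "u \<noteq> v" "(u, v) \<notin> parcs G"
proof -
  have path: "apath u p v" and shortest: "\<And>q. apath u q v \<Longrightarrow> length p \<le> length q"
    using assms(1) by (auto simp: geodesic_def)
  have "u \<in> pverts G" "v \<in> pverts G"
    using path by (auto simp: apath_def dest: awalk_hd_in_verts awalk_last_in_verts)
  moreover have "u \<noteq> v"
    using path assms(2) by (metis apath_nonempty_ends list.size(3) not_numeral_le_zero)
  moreover have nonadjacent: "(u, v) \<notin> parcs G"
    using shortest[OF apath_arc] assms(2) by fastforce
  ultimately obtain w where "(u, w) \<in> parcs G" "(w, v) \<in> parcs G"
    using common_neighbour by blast
  then have "length p = 2"
    using shortest[OF apath_two_arcs] \<open>u \<noteq> v\<close> assms(2) by fastforce
  then obtain e f where "p = [e, f]"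
    by (auto simp: numeral_2_eq_2 length_Suc_conv)
  with path obtain w' where "p = [(u, w'), (w', v)]" "(u, w') \<in> parcs G" "(w', v) \<in> parcs G"
    by (cases e; cases f) (auto simp: apath_def awalk_Cons_iff awalk_Nil_iff)
  then show thesis
    using that \<open>u \<noteq> v\<close> nonadjacent by blast
qed

theorem general_position_set_iff_induced_P3_free:
  "general_position_set G S \<longleftrightarrow> S \<subseteq> pverts G \<and> induced_P3_free G S"
proof (intro iffI conjI)
  show "S \<subseteq> pverts G" "induced_P3_free G S" if "general_position_set G S"
    using that general_position_set_induced_P3_free by (simp_all add: general_position_set_def)
next
  assume "S \<subseteq> pverts G \<and> induced_P3_free G S"
  then have subset: "S \<subseteq> pverts G" and P3_free: "induced_P3_free G S"
    by simp_all
  show "general_position_set G S"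
  proof (rule general_position_setI)
    show "S \<subseteq> pverts G"
      by (rule subset)
    fix x y z u p v
    assume xyz: "x \<in> S" "y \<in> S" "z \<in> S" and distinct: "x \<noteq> y" "y \<noteq> z" "x \<noteq> z"
      and geodesic: "geodesic G u p v" and on_path: "{x, y, z} \<subseteq> set (awalk_verts u p)"
    have "card {x, y, z} \<le> length (awalk_verts u p)"
      using on_path by (meson List.finite_set card_length card_mono le_trans)
    then have "2 \<le> length p"
      using distinct by (simp add: length_awalk_verts)
    with geodesic obtain w where induced_path: "p = [(u, w), (w, v)]"
      "(u, w) \<in> parcs G" "(w, v) \<in> parcs G" "u \<noteq> v" "(u, v) \<notin> parcs G"
      by (rule geodesic_of_length_ge_two)
    then have "{u, w, v} = {x, y, z}"
      using on_path distinct by auto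
    with xyz have "{u, w, v} \<subseteq> S"
      by simp
    then show False
      using induced_P3_freeD[OF P3_free, of u w v] induced_path by simp
  qed
qed

lemma clique_general_position_set: "clique G S \<Longrightarrow> general_position_set G S"
  by (simp add: general_position_set_iff_induced_P3_free clique_induced_P3_free
      clique_subset_pverts)

end

section \<open>Plays of the general position avoidance game\<close>

lemma legal_play_Nil [simp]: "legal_play G []"
  by (simp add: legal_play_def)

lemma legal_play_snoc:
  "legal_play G (xs @ [x]) \<longleftrightarrow> legal_play G xs \<and> x \<in> legal_moves G xs"
  by (auto simp: legal_play_def nth_append less_Suc_eq)

lemma legal_play_singleton [simp]: "legal_play G [x] \<longleftrightarrow> x \<in> legal_moves G []"
  using legal_play_snoc[of G "[]"] by simp

lemma legal_play_take: "legal_play G xs \<Longrightarrow> legal_play G (take k xs)"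
  by (auto simp: legal_play_def)

lemma legal_play_distinct: "legal_play G xs \<Longrightarrow> distinct xs"
  by (induction xs rule: rev_induct) (auto simp: legal_play_snoc legal_moves_def)

lemma legal_play_general_position_set:
  "legal_play G xs \<Longrightarrow> general_position_set G (set xs)"
  by (cases xs rule: rev_cases)
    (auto simp: legal_play_snoc legal_moves_def general_position_set_def)

lemma legal_play_length_le_card_pverts:
  assumes "finite (pverts G)" "legal_play G xs"
  shows "length xs \<le> card (pverts G)"
  using assms card_mono[of "pverts G" "set xs"] legal_play_general_position_set[of G xs]
    distinct_card[OF legal_play_distinct[of G xs]]
  by (simp add: general_position_set_def)

lemma follows_snoc:
  "follows X \<sigma> (xs @ [x]) \<longleftrightarrow> follows X \<sigma> xs \<and> (to_move (length xs) = X \<longrightarrow> x = \<sigma> xs)"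
  by (auto simp: follows_def nth_append less_Suc_eq)

lemma follows_singleton_Player_B [simp]: "follows Player_B \<sigma> [x]"
  by (simp add: follows_def to_move_def)

definition complete_play :: "'a pair_pre_digraph \<Rightarrow> 'a list \<Rightarrow> bool" where
  "complete_play G xs \<longleftrightarrow> legal_play G xs \<and> legal_moves G xs = {}"

lemma complete_play_general_position_set:
  "complete_play G xs \<Longrightarrow> general_position_set G (set xs)"
  by (simp add: complete_play_def legal_play_general_position_set)

lemma (in diameter_two_graph) legal_moves_Nil: "legal_moves G [] = pverts G"
  using clique_general_position_set by (auto simp: legal_moves_def clique_def)

lemma (in diameter_two_graph) complete_play_maximal_clique:
  assumes "complete_play G xs" "clique G (set xs)"
  shows "maximal_clique G (set xs)"
proof -
  have "v \<in> set xs" if "clique G (insert v (set xs))" for v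
  proof -
    have "v \<in> pverts G" "general_position_set G (insert v (set xs))"
      using that clique_general_position_set[OF that] by (simp_all add: clique_def)
    then show ?thesis
      using assms(1) by (auto simp: complete_play_def legal_moves_def)
  qed
  then show ?thesis
    using assms(2) by (simp add: maximal_clique_def)
qed

lemma winning_strategy_Player_B_iff:
  "winning_strategy G Player_B \<sigma> \<longleftrightarrow>
     (\<forall>xs. legal_play G xs \<and> follows Player_B \<sigma> xs \<and> odd (length xs) \<and> legal_moves G xs \<noteq> {} \<longrightarrow>
        \<sigma> xs \<in> legal_moves G xs) \<and>
     (\<forall>xs. complete_play G xs \<and> follows Player_B \<sigma> xs \<longrightarrow> odd (length xs))"
proof -
  have to_move: "to_move k = Player_B \<longleftrightarrow> odd k" for k
    by (simp add: to_move_def)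
  have last_move: "xs \<noteq> [] \<and> \<not> odd (length xs - 1) \<longleftrightarrow> odd (length xs)" for xs :: "'a list"
    by (cases xs) auto
  show ?thesis
    unfolding winning_strategy_def complete_play_def to_move last_move by blast
qed

lemma winning_strategy_extends_to_complete_play:
  assumes "finite (pverts G)" "winning_strategy G X \<sigma>" "legal_play G xs" "follows X \<sigma> xs"
  shows "\<exists>ys. complete_play G (xs @ ys) \<and> follows X \<sigma> (xs @ ys)"
  using assms(3,4)
proof (induction "card (pverts G) - length xs" arbitrary: xs rule: less_induct)
  case less
  show ?case
  proof (cases "legal_moves G xs = {}")
    case True
    then show ?thesis
      using less.prems by (intro exI[of _ "[]"]) (simp add: complete_play_def)
  next
    case False
    with assms(2) less.prems
    have "\<exists>v \<in> legal_moves G xs. to_move (length xs) = X \<longrightarrow> v = \<sigma> xs"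
      unfolding winning_strategy_def by blast
    then obtain v where v: "legal_play G (xs @ [v])" "follows X \<sigma> (xs @ [v])"
      using less.prems by (auto simp: legal_play_snoc follows_snoc)
    have "card (pverts G) - length (xs @ [v]) < card (pverts G) - length xs"
      using legal_play_length_le_card_pverts[OF assms(1) v(1)] by simp
    from less.hyps[OF this v] obtain ys
      where "complete_play G ((xs @ [v]) @ ys) \<and> follows X \<sigma> ((xs @ [v]) @ ys)"
      by blast
    then show ?thesis
      by (intro exI[of _ "v # ys"]) simp
  qed
qed

lemma Player_B_loses_if_opening_forces_even_length:
  assumes "finite (pverts G)" "v \<in> legal_moves G []"
    and even: "\<And>xs. complete_play G (v # xs) \<Longrightarrow> even (length (v # xs))"
  shows "\<not> wins_gp_avoidance Player_B G"
proof
  assume "wins_gp_avoidance Player_B G"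
  then obtain \<sigma> where \<sigma>: "winning_strategy G Player_B \<sigma>"
    by (auto simp: wins_gp_avoidance_def)
  have "\<exists>ys. complete_play G ([v] @ ys) \<and> follows Player_B \<sigma> ([v] @ ys)"
    using assms(2) by (intro winning_strategy_extends_to_complete_play[OF assms(1) \<sigma>]) simp_all
  then obtain xs where xs: "complete_play G (v # xs)" "follows Player_B \<sigma> (v # xs)"
    by auto
  then have "odd (length (v # xs))"
    using \<sigma> unfolding winning_strategy_Player_B_iff by blast
  then show False
    using even[OF xs(1)] by blast
qed

lemma Player_B_wins_if_reply_forces_odd_length:
  assumes first_move: "legal_moves G [] \<noteq> {}"
    and good_reply: "\<And>v. v \<in> legal_moves G [] \<Longrightarrow>
      \<exists>w \<in> legal_moves G [v]. \<forall>xs. complete_play G (v # w # xs) \<longrightarrow> odd (length (v # w # xs))"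
  shows "wins_gp_avoidance Player_B G"
proof -
  obtain reply where legal: "reply v \<in> legal_moves G [v]"
      and odd: "complete_play G (v # reply v # xs) \<Longrightarrow> odd (length (v # reply v # xs))"
    if "v \<in> legal_moves G []" for v xs
    using good_reply by metis
  define \<sigma> where
    "\<sigma> xs = (if length xs = 1 then reply (hd xs) else SOME v. v \<in> legal_moves G xs)" for xs
  have "winning_strategy G Player_B \<sigma>"
    unfolding winning_strategy_Player_B_iff
  proof (intro conjI allI impI; elim conjE)
    fix xs assume play: "legal_play G xs" and nonempty: "legal_moves G xs \<noteq> {}"
    show "\<sigma> xs \<in> legal_moves G xs"
    proof (cases "length xs = 1")
      case True
      then obtain v where "xs = [v]"
        by (auto simp: length_Suc_conv)
      then show ?thesis
        using legal play by (simp add: \<sigma>_def)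
    next
      case False
      then show ?thesis
        using nonempty by (simp add: \<sigma>_def some_in_eq)
    qed
  next
    fix xs assume complete: "complete_play G xs" and follows: "follows Player_B \<sigma> xs"
    then obtain v ys where xs: "xs = v # ys" and v: "v \<in> legal_moves G []"
      using first_move legal_play_take[of G xs 1] by (cases xs) (auto simp: complete_play_def)
    moreover have "ys \<noteq> []"
      using complete legal[OF v] unfolding xs complete_play_def by auto
    ultimately obtain w zs where "xs = v # w # zs"
      by (cases ys) auto
    moreover from this have "w = reply v"
      using follows by (auto simp: follows_def to_move_def \<sigma>_def dest: spec[of _ 1])
    ultimately show "odd (length xs)"
      using odd[OF v] complete by blast
  qed
  then show ?thesis
    by (auto simp: wins_gp_avoidance_def)
qed

section \<open>The game on a join\<close>

lemma pverts_graph_join [simp]: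
  "Inl u \<in> pverts (graph_join G H) \<longleftrightarrow> u \<in> pverts G"
  "Inr v \<in> pverts (graph_join G H) \<longleftrightarrow> v \<in> pverts H"
  by (auto simp: graph_join_def)

lemma parcs_graph_join [simp]:
  "(Inl u, Inl u') \<in> parcs (graph_join G H) \<longleftrightarrow> (u, u') \<in> parcs G"
  "(Inr v, Inr v') \<in> parcs (graph_join G H) \<longleftrightarrow> (v, v') \<in> parcs H"
  "(Inl u, Inr v) \<in> parcs (graph_join G H) \<longleftrightarrow> u \<in> pverts G \<and> v \<in> pverts H"
  "(Inr v, Inl u) \<in> parcs (graph_join G H) \<longleftrightarrow> u \<in> pverts G \<and> v \<in> pverts H"
  by (auto simp: graph_join_def)

lemma clique_graph_join_iff:
  "clique (graph_join G H) S \<longleftrightarrow> clique G (Inl -` S) \<and> clique H (Inr -` S)"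
  by (auto simp: clique_def pairwise_def subset_iff split_sum_all Ball_def)

lemma maximal_clique_graph_join:
  assumes "maximal_clique (graph_join G H) S"
  shows "maximal_clique G (Inl -` S)" "maximal_clique H (Inr -` S)"
proof -
  have clique: "clique G (Inl -` S)" "clique H (Inr -` S)"
    and maximal: "\<And>x. clique (graph_join G H) (insert x S) \<Longrightarrow> x \<in> S"
    using assms by (simp_all add: maximal_clique_def clique_graph_join_iff)
  have "Inl -` insert (Inl u) S = insert u (Inl -` S)" "Inr -` insert (Inl u) S = Inr -` S" for u
    by auto
  then have "u \<in> Inl -` S" if "clique G (insert u (Inl -` S))" for u
    using maximal[of "Inl u"] that clique(2) by (simp add: clique_graph_join_iff)
  with clique(1) show "maximal_clique G (Inl -` S)"
    by (simp add: maximal_clique_def)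
  have "Inl -` insert (Inr v) S = Inl -` S" "Inr -` insert (Inr v) S = insert v (Inr -` S)" for v
    by auto
  then have "v \<in> Inr -` S" if "clique H (insert v (Inr -` S))" for v
    using maximal[of "Inr v"] that clique(1) by (simp add: clique_graph_join_iff)
  with clique(2) show "maximal_clique H (Inr -` S)"
    by (simp add: maximal_clique_def)
qed

lemma card_vimage_Inl_Inr:
  assumes "finite S"
  shows "card (Inl -` S) + card (Inr -` S) = card S"
proof -
  have "S = (Inl -` S) <+> (Inr -` S)"
    by (auto simp: set_eq_iff split_sum_all)
  then show ?thesis
    using assms by (metis card_Plus finite_vimageI inj_Inl inj_Inr)
qed

locale nonempty_join =
  fixes G :: "'a pair_pre_digraph" and H :: "'b pair_pre_digraph"
  assumes pair_graph_join: "pair_graph (graph_join G H)"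
    and pverts_nonempty: "pverts G \<noteq> {}" "pverts H \<noteq> {}"
begin

sublocale join: diameter_two_graph "graph_join G H"
proof (rule diameter_two_graph.intro[OF pair_graph_join], unfold_locales)
  obtain a b where "a \<in> pverts G" "b \<in> pverts H"
    using pverts_nonempty by blast
  then show "\<exists>z. (x, z) \<in> parcs (graph_join G H) \<and> (z, y) \<in> parcs (graph_join G H)"
    if "x \<in> pverts (graph_join G H)" "y \<in> pverts (graph_join G H)"
      "(x, y) \<notin> parcs (graph_join G H)" for x y
    using that by (cases x; cases y) (auto intro: exI[of _ "Inl a"] exI[of _ "Inr b"])
qed

lemma mixed_general_position_set_clique:
  assumes "general_position_set (graph_join G H) S" "Inl u \<in> S" "Inr v \<in> S"
  shows "clique (graph_join G H) S"
proof -
  have S: "S \<subseteq> pverts (graph_join G H)" "induced_P3_free (graph_join G H) S"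
    using assms(1) by (simp_all add: join.general_position_set_iff_induced_P3_free)
  have "(x, y) \<in> parcs (graph_join G H)" if "x \<in> S" "y \<in> S" "x \<noteq> y" for x y
  proof -
    have "x \<in> pverts (graph_join G H)" "y \<in> pverts (graph_join G H)"
      "u \<in> pverts G" "v \<in> pverts H"
      using S(1) that assms(2,3) by auto
    then show ?thesis
      using induced_P3_freeD[OF S(2) that(1) assms(2) that(2)]
        induced_P3_freeD[OF S(2) that(1) assms(3) that(2)] that(3)
      by (cases x; cases y) auto
  qed
  then show ?thesis
    using S(1) by (simp add: clique_def pairwise_def)
qed

lemma general_position_set_clique_if_complete:
  assumes "clique H (pverts H)" "general_position_set (graph_join G H) S" "Inr v \<in> S"
  shows "clique (graph_join G H) S"
proof (cases "\<exists>u. Inl u \<in> S")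
  case True
  then show ?thesis
    using mixed_general_position_set_clique assms(2,3) by blast
next
  case False
  then have "Inl -` S = {}" "Inr -` S \<subseteq> pverts H"
    using assms(2) by (auto simp: general_position_set_def)
  then show ?thesis
    using clique_subset[OF assms(1)] by (simp add: clique_graph_join_iff)
qed

lemma complete_clique_play_length:
  assumes "complete_play (graph_join G H) xs" "clique (graph_join G H) (set xs)"
  obtains A B where "maximal_clique G A" "maximal_clique H B" "length xs = card A + card B"
proof
  have "maximal_clique (graph_join G H) (set xs)"
    using assms by (rule join.complete_play_maximal_clique)
  then show "maximal_clique G (Inl -` set xs)" "maximal_clique H (Inr -` set xs)"
    by (rule maximal_clique_graph_join)+
  show "length xs = card (Inl -` set xs :: 'a set) + card (Inr -` set xs :: 'b set)"
    using assms(1) distinct_card[OF legal_play_distinct, of "graph_join G H" xs]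
    by (auto simp: complete_play_def card_vimage_Inl_Inr)
qed

lemma cross_reply_legal:
  assumes "x \<in> pverts (graph_join G H)"
  obtains y u v where "y \<in> legal_moves (graph_join G H) [x]" "{x, y} = {Inl u, Inr v}"
proof -
  obtain y u v where xy: "{x, y} = {Inl u, Inr v}" "u \<in> pverts G" "v \<in> pverts H"
  proof (cases x)
    case (Inl u)
    moreover obtain v where "v \<in> pverts H"
      using pverts_nonempty(2) by blast
    ultimately show thesis
      using assms that[of "Inr v" u v] by simp
  next
    case (Inr v)
    moreover obtain u where "u \<in> pverts G"
      using pverts_nonempty(1) by blast
    ultimately show thesis
      using assms that[of "Inl u" u v] by (simp add: insert_commute)
  qed
  have "clique (graph_join G H) {x, y}"
    using xy(2,3) unfolding xy(1) by (auto simp: clique_def pairwise_insert)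
  moreover have "x \<noteq> y"
    using xy(1) by auto
  ultimately have "y \<in> legal_moves (graph_join G H) [x]"
    using join.clique_general_position_set[of "{y, x}"]
    by (simp add: legal_moves_def clique_def insert_commute)
  then show thesis
    using that xy(1) by blast
qed

theorem Player_B_wins_if_maximal_cliques_odd:
  assumes "\<And>A B. maximal_clique G A \<Longrightarrow> maximal_clique H B \<Longrightarrow> odd (card A + card B)"
  shows "wins_gp_avoidance Player_B (graph_join G H)"
proof (rule Player_B_wins_if_reply_forces_odd_length)
  obtain a where "a \<in> pverts G"
    using pverts_nonempty(1) by blast
  then have "Inl a \<in> legal_moves (graph_join G H) []"
    by (simp add: join.legal_moves_Nil)
  then show "legal_moves (graph_join G H) [] \<noteq> {}"
    by blast
next
  fix x assume "x \<in> legal_moves (graph_join G H) []"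
  then have "x \<in> pverts (graph_join G H)"
    by (simp add: join.legal_moves_Nil)
  then obtain y u v
    where legal: "y \<in> legal_moves (graph_join G H) [x]" and mixed: "{x, y} = {Inl u, Inr v}"
    by (rule cross_reply_legal)
  have "odd (length (x # y # zs))" if zs: "complete_play (graph_join G H) (x # y # zs)" for zs
  proof -
    have "Inl u \<in> set (x # y # zs)" "Inr v \<in> set (x # y # zs)"
      using mixed by auto
    with complete_play_general_position_set[OF zs] have "clique (graph_join G H) (set (x # y # zs))"
      by (rule mixed_general_position_set_clique)
    then show ?thesis
      using complete_clique_play_length[OF zs] assms by metis
  qed
  with legal show "\<exists>y \<in> legal_moves (graph_join G H) [x].
      \<forall>zs. complete_play (graph_join G H) (x # y # zs) \<longrightarrow> odd (length (x # y # zs))"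
    by blast
qed

theorem Player_B_loses_if_maximal_cliques_even:
  assumes "clique H (pverts H)"
    and "\<And>A B. maximal_clique G A \<Longrightarrow> maximal_clique H B \<Longrightarrow> even (card A + card B)"
  shows "\<not> wins_gp_avoidance Player_B (graph_join G H)"
proof -
  obtain b where "b \<in> pverts H"
    using pverts_nonempty(2) by blast
  show ?thesis
  proof (rule Player_B_loses_if_opening_forces_even_length)
    show "finite (pverts (graph_join G H))"
      by (rule join.pair_finite_verts)
    show "Inr b \<in> legal_moves (graph_join G H) []"
      using \<open>b \<in> pverts H\<close> by (simp add: join.legal_moves_Nil)
    fix xs assume xs: "complete_play (graph_join G H) (Inr b # xs)"
    have "clique (graph_join G H) (set (Inr b # xs))"
      using complete_play_general_position_set[OF xs]
      by (rule general_position_set_clique_if_complete[OF assms(1), of _ b]) simp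
    then show "even (length (Inr b # xs))"
      using complete_clique_play_length[OF xs] assms(2) by metis
  qed
qed

end

section \<open>Maximal cliques of edgeless graphs and cycles\<close>

lemma card_maximal_clique_edgeless_graph:
  assumes "n \<ge> 1" "maximal_clique (edgeless_graph n) S"
  shows "card S = 1"
proof -
  have "clique (edgeless_graph n) S"
    using assms(2) by (simp add: maximal_clique_def)
  then have "x = y" if "x \<in> S" "y \<in> S" for x y
    using that by (auto simp: clique_def pairwise_def edgeless_graph_def)
  moreover have "clique (edgeless_graph n) {0}"
    using assms(1) by (simp add: clique_def edgeless_graph_def)
  then have "S \<noteq> {}"
    using assms(2) by (auto simp: maximal_clique_def)
  ultimately show ?thesis
    by (metis is_singletonI' is_singleton_altdef)
qed

lemma pverts_cycle_graph [simp]: "pverts (cycle_graph m) = {..<m}"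
  by (simp add: cycle_graph_def)

lemma parcs_cycle_graph_iff:
  "(i, j) \<in> parcs (cycle_graph m) \<longleftrightarrow> i < m \<and> j < m \<and> (j = Suc i mod m \<or> i = Suc j mod m)"
  by (simp add: cycle_graph_def)

lemma cycle_graph_triangle_free:
  assumes "m \<ge> 4" "(a, b) \<in> parcs (cycle_graph m)" "(b, c) \<in> parcs (cycle_graph m)"
  shows "(a, c) \<notin> parcs (cycle_graph m)"
proof -
  have successor: "l = Suc k mod m \<longleftrightarrow> l = Suc k \<and> l < m \<or> l = 0 \<and> Suc k = m" if "k < m" for k l
    using that by (cases "Suc k = m") auto
  have "a < m" "b < m" "c < m"
    using assms(2,3) by (auto simp: parcs_cycle_graph_iff)
  then show ?thesis
    using assms unfolding parcs_cycle_graph_iff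
      successor[OF \<open>a < m\<close>] successor[OF \<open>b < m\<close>] successor[OF \<open>c < m\<close>]
    by linarith
qed

lemma card_clique_cycle_graph_le_2:
  assumes "m \<ge> 4" "clique (cycle_graph m) S"
  shows "card S \<le> 2"
proof (rule ccontr)
  assume "\<not> card S \<le> 2"
  then obtain T where "T \<subseteq> S" "card T = 3"
    using obtain_subset_with_card_n[of 3 S] by auto
  then obtain a b c where "T = {a, b, c}" "a \<noteq> b" "b \<noteq> c" "a \<noteq> c"
    by (auto simp: card_3_iff)
  then have "(a, b) \<in> parcs (cycle_graph m)" "(b, c) \<in> parcs (cycle_graph m)"
      "(a, c) \<in> parcs (cycle_graph m)"
    using clique_subset[OF assms(2) \<open>T \<subseteq> S\<close>] by (auto simp: clique_def pairwise_def)
  then show False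
    using cycle_graph_triangle_free[OF assms(1)] by blast
qed

lemma card_maximal_clique_cycle_graph:
  assumes "m \<ge> 4" "maximal_clique (cycle_graph m) S"
  shows "card S = 2"
proof -
  have clique: "clique (cycle_graph m) S"
    and maximal: "\<And>v. clique (cycle_graph m) (insert v S) \<Longrightarrow> v \<in> S"
    using assms(2) by (auto simp: maximal_clique_def)
  have "S \<noteq> {}"
    using maximal[of 0] assms(1) by (auto simp: clique_def)
  then obtain a where a: "a \<in> S" "a < m"
    using clique by (auto simp: clique_def)
  have "clique (cycle_graph m) {a, Suc a mod m}"
    using a(2) assms(1) by (auto simp: clique_def pairwise_def parcs_cycle_graph_iff)
  moreover have "Suc a mod m \<noteq> a"
    using a(2) assms(1) by (cases "Suc a = m") auto
  ultimately have "S \<noteq> {a}"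
    using maximal[of "Suc a mod m"] by (auto simp: insert_commute)
  then have "card S \<noteq> 1"
    using a(1) by (auto simp: card_1_singleton_iff)
  moreover have "card S \<noteq> 0"
    using \<open>S \<noteq> {}\<close> clique by (auto simp: clique_def dest: finite_subset)
  ultimately show ?thesis
    using card_clique_cycle_graph_le_2[OF assms(1) clique] by linarith
qed

lemma clique_cycle_graph_3: "clique (cycle_graph 3) (pverts (cycle_graph 3))"
proof -
  have "j = Suc i mod 3 \<or> i = Suc j mod 3" if "i < 3" "j < 3" "i \<noteq> j" for i j :: nat
  proof -
    have "i \<in> {0, 1, 2}" "j \<in> {0, 1, 2}"
      using that by auto
    then show ?thesis
      using \<open>i \<noteq> j\<close> by auto
  qed
  then show ?thesis
    by (simp add: clique_def pairwise_def parcs_cycle_graph_iff)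
qed

lemma card_maximal_clique_cycle_graph_3: "maximal_clique (cycle_graph 3) S \<Longrightarrow> card S = 3"
  by (drule maximal_clique_eq_pverts[OF clique_cycle_graph_3]) simp

lemma nonempty_join_edgeless_cycle:
  assumes "n \<ge> 1" "m \<ge> 3"
  shows "nonempty_join (edgeless_graph n) (cycle_graph m)"
  using assms pair_graph_wheel_join[OF assms(2), of n]
  by (intro nonempty_join.intro) (auto simp: wheel_join_def edgeless_graph_def lessThan_empty_iff)

theorem theorem2p6:
  fixes n m :: nat
  assumes "n \<ge> 1" and "m \<ge> 3"
  shows "wins_gp_avoidance Player_B (wheel_join n m) \<longleftrightarrow> m \<ge> 4"
proof -
  interpret nonempty_join "edgeless_graph n" "cycle_graph m"
    using assms by (rule nonempty_join_edgeless_cycle)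
  show ?thesis
  proof (cases "m \<ge> 4")
    case True
    then have "wins_gp_avoidance Player_B (wheel_join n m)"
      unfolding wheel_join_def using assms(1)
      by (intro Player_B_wins_if_maximal_cliques_odd)
        (simp add: card_maximal_clique_edgeless_graph card_maximal_clique_cycle_graph)
    with True show ?thesis
      by simp
  next
    case False
    then have "m = 3"
      using assms(2) by simp
    then have "\<not> wins_gp_avoidance Player_B (wheel_join n m)"
      unfolding wheel_join_def using assms(1) clique_cycle_graph_3
      by (intro Player_B_loses_if_maximal_cliques_even)
        (simp_all add: card_maximal_clique_edgeless_graph card_maximal_clique_cycle_graph_3)
    with False show ?thesis
      by simp
  qed
qed

end
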